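(* Let $A\in GL(n,\mathbb{C})$ and let $\Omega\subset\mathbb{C}^n$ be a domain that is positive-time flow invariant with respect to $A$ (that is, $e^{tA}(\Omega)\subset\Omega$ for every $t\ge 0$) and satisfies $E^{cu}\subset\Omega$. Suppose that for every compact set $K\subset\mathbb{C}^n$ there exists $T_K>0$ such that $$\operatorname{dist}\bigl(e^{tA}P^{cu}(K),\partial\Omega\bigr)>\sup_{z\in K}\|e^{tA}P^s z\|\qquad\text{for all } t\ge T_K.$$ Then $\Omega$ is a Runge domain.
   Context: A domain is a connected open set. For $A\in GL(n,\mathbb{C})$ let $\lambda_1,\dots,\lambda_m$ be its distinct eigenvalues and $m_j$ the size of the largest Jordan block of $A$ for $\lambda_j$. The stable, unstable and center subspaces of $A$ are $$E^s=\bigoplus_{\operatorname{Re}\lambda_j<0}\ker (A-\lambda_jI)^{m_j},\quad E^u=\bigoplus_{\operatorname{Re}\lambda_j>0}\ker (A-\lambda_jI)^{m_j},\quad E^c=\bigoplus_{\operatorname{Re}\lambda_j=0}\ker (A-\lambda_jI)^{m_j},$$ so that $\mathbb{C}^n=E^s\oplus E^u\oplus E^c$. Put $E^{cu}:=E^u\oplus E^c$, and let $P^s:\mathbb{C}^n\to E^s$ and $P^{cu}:\mathbb{C}^n\to E^{cu}$ be the projections associated with the splitting $\mathbb{C}^n=E^s\oplus E^{cu}$. $\|\cdot\|$ is the Euclidean norm. For $S\subset\mathbb{C}^n$, $\operatorname{dist}(S,\partial\Omega):=\inf\{\|x-y\|:x\in S,\ y\in\partial\Omega\}$ (with the infimum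 of the empty set equal to $+\infty$). A domain $\Omega\subset\mathbb{C}^n$ is Runge if every holomorphic function on $\Omega$ can be approximated, uniformly on compact subsets of $\Omega$, by holomorphic polynomials. *)

theory Defs
  imports
    "Jordan_Normal_Form.Jordan_Normal_Form"
    "HOL-Analysis.Analysis"
begin

(* Both libraries use $ for indexing and call a constant "mat". *)
no_notation Matrix.vec_index (infixl \<open>$\<close> 100)
hide_const (open) Matrix.mat

section \<open>Powers and exponential of a square matrix\<close>

(* The type class operations * and ^ are componentwise on complex ^ 'n ^ 'n. *)
definition matrix_power :: "complex ^ 'n ^ 'n \<Rightarrow> nat \<Rightarrow> complex ^ 'n ^ 'n" where
  "matrix_power A k = (((**) A) ^^ k) (mat 1)"

definition matrix_exp :: "complex ^ 'n ^ 'n \<Rightarrow> complex ^ 'n ^ 'n" where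
  "matrix_exp A = (\<Sum>k. (1 / fact k) *\<^sub>R matrix_power A k)"


section \<open>Stable, unstable and center subspaces\<close>

definition eigenvalues :: "complex ^ 'n ^ 'n \<Rightarrow> complex set" where
  "eigenvalues A = {l. \<exists>v. v \<noteq> 0 \<and> A *v v = l *s v}"

(* The matrix over the index set {0..<CARD('n)} obtained from A through an enumeration of
   the index type. Another enumeration gives a similar matrix, so the Jordan normal form does
   not depend on this choice. *)
definition indexed_mat :: "complex ^ 'n ^ 'n \<Rightarrow> complex Matrix.mat" where
  "indexed_mat A = Matrix.mat CARD('n) CARD('n)
     (\<lambda>(i, j). A $ (from_nat_into UNIV i) $ (from_nat_into UNIV j))"

(* Jordan normal forms of a matrix are lists of (block size, eigenvalue), unique up to the order
   of the blocks, so the set below consists of the sizes of the blocks for l. *)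
definition largest_jordan_block :: "complex ^ 'n ^ 'n \<Rightarrow> complex \<Rightarrow> nat" where
  "largest_jordan_block A l =
     Max {m. \<exists>n_as. jordan_nf (indexed_mat A) n_as \<and> (m, l) \<in> set n_as}"

definition gen_eigenspace :: "complex ^ 'n ^ 'n \<Rightarrow> complex \<Rightarrow> (complex ^ 'n) set" where
  "gen_eigenspace A l = {v. matrix_power (A - mat l) (largest_jordan_block A l) *v v = 0}"

(* vec.span is the span over the complex numbers, so the span of a union of subspaces is
   their sum. *)
definition stable_subspace :: "complex ^ 'n ^ 'n \<Rightarrow> (complex ^ 'n) set" where
  "stable_subspace A = vec.span (\<Union>l\<in>{l \<in> eigenvalues A. Re l < 0}. gen_eigenspace A l)"

definition unstable_subspace :: "complex ^ 'n ^ 'n \<Rightarrow> (complex ^ 'n) set" where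
  "unstable_subspace A = vec.span (\<Union>l\<in>{l \<in> eigenvalues A. Re l > 0}. gen_eigenspace A l)"

definition center_subspace :: "complex ^ 'n ^ 'n \<Rightarrow> (complex ^ 'n) set" where
  "center_subspace A = vec.span (\<Union>l\<in>{l \<in> eigenvalues A. Re l = 0}. gen_eigenspace A l)"

definition center_unstable_subspace :: "complex ^ 'n ^ 'n \<Rightarrow> (complex ^ 'n) set" where
  "center_unstable_subspace A = {x + y | x y. x \<in> unstable_subspace A \<and> y \<in> center_subspace A}"

(* The projection onto S along T, meaningful when the whole space is the direct sum of S and T. *)
definition proj_along ::
    "(complex ^ 'n) set \<Rightarrow> (complex ^ 'n) set \<Rightarrow> complex ^ 'n \<Rightarrow> complex ^ 'n" where
  "proj_along S T z = (THE x. x \<in> S \<and> z - x \<in> T)"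

definition stable_proj :: "complex ^ 'n ^ 'n \<Rightarrow> complex ^ 'n \<Rightarrow> complex ^ 'n" where
  "stable_proj A = proj_along (stable_subspace A) (center_unstable_subspace A)"

definition center_unstable_proj :: "complex ^ 'n ^ 'n \<Rightarrow> complex ^ 'n \<Rightarrow> complex ^ 'n" where
  "center_unstable_proj A = proj_along (center_unstable_subspace A) (stable_subspace A)"


section \<open>Domains, flow invariance and distance\<close>

definition is_domain :: "(complex ^ 'n) set \<Rightarrow> bool" where
  "is_domain \<Omega> \<longleftrightarrow> open \<Omega> \<and> connected \<Omega>"

definition positive_time_flow_invariant ::
    "complex ^ 'n ^ 'n \<Rightarrow> (complex ^ 'n) set \<Rightarrow> bool" where
  "positive_time_flow_invariant A \<Omega> \<longleftrightarrow>
     (\<forall>t\<ge>0. (\<lambda>z. matrix_exp (t *\<^sub>R A) *v z) ` \<Omega> \<subseteq> \<Omega>)"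

(* Extended-real valued, so that the distance to the empty set is infinite
   (the library's setdist would give 0). *)
definition set_dist :: "(complex ^ 'n) set \<Rightarrow> (complex ^ 'n) set \<Rightarrow> ereal" where
  "set_dist S T = Inf {ereal (norm (x - y)) | x y. x \<in> S \<and> y \<in> T}"


section \<open>Holomorphic functions of several variables and Runge domains\<close>

(* Complex differentiability: the Frechet derivative exists and is complex linear. *)
definition holomorphic_several :: "(complex ^ 'n \<Rightarrow> complex) \<Rightarrow> (complex ^ 'n) set \<Rightarrow> bool" where
  "holomorphic_several f \<Omega> \<longleftrightarrow>
     (\<forall>z\<in>\<Omega>. \<exists>D. (f has_derivative D) (at z) \<and> (\<forall>c v. D (c *s v) = c * D v))"

definition holomorphic_polynomial :: "(complex ^ 'n \<Rightarrow> complex) \<Rightarrow> bool" where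
  "holomorphic_polynomial p \<longleftrightarrow>
     (\<exists>(M :: ('n \<Rightarrow> nat) set) c. finite M \<and>
        p = (\<lambda>z. \<Sum>\<alpha>\<in>M. c \<alpha> * (\<Prod>i\<in>UNIV. (z $ i) ^ \<alpha> i)))"

definition runge_domain :: "(complex ^ 'n) set \<Rightarrow> bool" where
  "runge_domain \<Omega> \<longleftrightarrow> is_domain \<Omega> \<and>
     (\<forall>f. holomorphic_several f \<Omega> \<longrightarrow>
        (\<forall>K. compact K \<and> K \<subseteq> \<Omega> \<longrightarrow>
           (\<forall>\<epsilon>>0. \<exists>p. holomorphic_polynomial p \<and> (\<forall>z\<in>K. norm (f z - p z) < \<epsilon>))))"

end

theory Submission
  imports
    Defs
    "Jordan_Normal_Form.Jordan_Normal_Form_Existence"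
    "HOL-Complex_Analysis.Complex_Analysis"
begin

text \<open>
  Let \<open>f\<close> be holomorphic on \<open>\<Omega>\<close> and let \<open>K \<subseteq> \<Omega>\<close> be compact. For \<open>t \<ge> 0\<close> the function
  \<open>g t = (\<lambda>z. f (exp (t A) z))\<close> is defined near \<open>K\<close>, because the flow maps \<open>\<Omega>\<close> into itself. Two
  facts about the curve \<open>t \<mapsto> g t\<close> in the space of continuous functions on \<open>K\<close> give the theorem.

  First, \<open>g t\<close> is a uniform limit of polynomials on \<open>K\<close> once \<open>t\<close> is large. Indeed, for a closed ball
  \<open>B\<close>, the distance hypothesis says that \<open>exp (t A) z\<close>, with \<open>z \<in> B\<close> and \<open>t\<close> large, differs from
  the point \<open>exp (t A) (P\<^sup>c\<^sup>u z)\<close> of \<open>E\<^sup>c\<^sup>u \<subseteq> \<Omega>\<close> by less than the distance from that point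
  to the boundary of \<open>\<Omega>\<close>. So \<open>exp (t A) z\<close> lies in \<open>\<Omega>\<close>, the function \<open>g t\<close> is holomorphic
  on a polydisc as large as desired, and there it can be expanded in powers of one coordinate after another
  (\<open>poly_approximable_on_polydisc\<close>).

  Secondly, \<open>t \<mapsto> g t\<close> is real analytic, since \<open>f (exp ((t + h) A) z)\<close> is holomorphic in
  small complex \<open>h\<close>, uniformly in \<open>z \<in> K\<close>. The uniform limits of polynomials form a closed subspace. An
  analytic curve that lies in a closed subspace for parameters immediately to the right of \<open>t0\<close> has
  its Taylor coefficients at \<open>t0\<close> in that subspace, and therefore lies in it on a full neighbourhood of \<open>t0\<close>
  (\<open>poly_approximable_continuation\<close>). Hence membership of \<open>g t\<close> propagates from large \<open>t\<close> down to
  \<open>t = 0\<close>, where \<open>g 0 = f\<close> (\<open>poly_approximable_of_entire_matrix_flow\<close>).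

  It remains to see that the projections behave as expected, that is, that the stable and the
  center-unstable subspace are complementary (\<open>stable_center_unstable_decomposition\<close>) and that the
  latter is invariant under the flow. The columns of the base change to Jordan normal form are
  generalized eigenvectors, so the generalized eigenspaces span. Sums of generalized eigenspaces over
  disjoint sets of eigenvalues meet only in \<open>0\<close>, because a vector in both has a minimal annihilating polynomial
  without roots.
\<close>

(* The dollar sign denotes entries of type-indexed vectors only, and mat the scalar matrices. *)
no_notation fps_nth (infixl \<open>$\<close> 75)
no_notation Matrix.vec_index (infixl \<open>$\<close> 100)
hide_const (open) Matrix.mat

section \<open>Holomorphic polynomials and their uniform limits\<close>

lemma holomorphic_polynomial_const: "holomorphic_polynomial (\<lambda>z. c)"
  unfolding holomorphic_polynomial_def
  by (rule exI[of _ "{\<lambda>_. 0}"], rule exI[of _ "\<lambda>_. c"]) simp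

lemma holomorphic_polynomial_coord:
  fixes i :: "'n :: finite"
  shows "holomorphic_polynomial (\<lambda>z :: complex ^ 'n. z $ i)"
proof -
  have "(\<Prod>j\<in>UNIV. (z $ j) ^ (if j = i then 1 else 0)) = z $ i" for z :: "complex ^ 'n"
    by (subst prod.remove[of _ i]) (auto intro!: prod.neutral)
  then show ?thesis
    unfolding holomorphic_polynomial_def
    by (intro exI[of _ "{\<lambda>j. if j = i then 1 else 0}"] exI[of _ "\<lambda>_. 1"]) auto
qed

lemma holomorphic_polynomial_add:
  assumes "holomorphic_polynomial p" "holomorphic_polynomial q"
  shows "holomorphic_polynomial (\<lambda>z. p z + q z)"
proof -
  obtain M c where M: "finite M" "p = (\<lambda>z. \<Sum>\<alpha>\<in>M. c \<alpha> * (\<Prod>i\<in>UNIV. (z $ i) ^ \<alpha> i))"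
    using assms(1) unfolding holomorphic_polynomial_def by blast
  obtain N d where N: "finite N" "q = (\<lambda>z. \<Sum>\<alpha>\<in>N. d \<alpha> * (\<Prod>i\<in>UNIV. (z $ i) ^ \<alpha> i))"
    using assms(2) unfolding holomorphic_polynomial_def by blast
  define c' where "c' = (\<lambda>\<alpha>. if \<alpha> \<in> M then c \<alpha> else 0)"
  define d' where "d' = (\<lambda>\<alpha>. if \<alpha> \<in> N then d \<alpha> else 0)"
  have "p z = (\<Sum>\<alpha>\<in>M \<union> N. c' \<alpha> * (\<Prod>i\<in>UNIV. (z $ i) ^ \<alpha> i))" for z
    unfolding M(2) using M(1) N(1) by (intro sum.mono_neutral_cong_left) (auto simp: c'_def)
  moreover have "q z = (\<Sum>\<alpha>\<in>M \<union> N. d' \<alpha> * (\<Prod>i\<in>UNIV. (z $ i) ^ \<alpha> i))" for z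
    unfolding N(2) using M(1) N(1) by (intro sum.mono_neutral_cong_left) (auto simp: d'_def)
  ultimately have "(\<lambda>z. p z + q z)
      = (\<lambda>z. \<Sum>\<alpha>\<in>M \<union> N. (c' \<alpha> + d' \<alpha>) * (\<Prod>i\<in>UNIV. (z $ i) ^ \<alpha> i))"
    by (simp add: sum.distrib distrib_right)
  then show ?thesis
    unfolding holomorphic_polynomial_def using M(1) N(1)
    by (intro exI[of _ "M \<union> N"] exI[of _ "\<lambda>\<alpha>. c' \<alpha> + d' \<alpha>"]) auto
qed

lemma holomorphic_polynomial_sum:
  assumes "\<And>j. j \<in> J \<Longrightarrow> holomorphic_polynomial (p j)"
  shows "holomorphic_polynomial (\<lambda>z. \<Sum>j\<in>J. p j z)"
  using assms
  by (induction J rule: infinite_finite_induct)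
    (auto intro: holomorphic_polynomial_const holomorphic_polynomial_add)

lemma holomorphic_polynomial_mult:
  assumes "holomorphic_polynomial p" "holomorphic_polynomial q"
  shows "holomorphic_polynomial (\<lambda>z. p z * q z)"
proof -
  obtain M c where M: "finite M" "p = (\<lambda>z. \<Sum>\<alpha>\<in>M. c \<alpha> * (\<Prod>i\<in>UNIV. (z $ i) ^ \<alpha> i))"
    using assms(1) unfolding holomorphic_polynomial_def by blast
  obtain N d where N: "finite N" "q = (\<lambda>z. \<Sum>\<alpha>\<in>N. d \<alpha> * (\<Prod>i\<in>UNIV. (z $ i) ^ \<alpha> i))"
    using assms(2) unfolding holomorphic_polynomial_def by blast
  have monomial: "holomorphic_polynomial (\<lambda>z. (c \<alpha> * (\<Prod>i\<in>UNIV. (z $ i) ^ \<alpha> i)) *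
      (d \<beta> * (\<Prod>i\<in>UNIV. (z $ i) ^ \<beta> i)))" for \<alpha> \<beta>
    unfolding holomorphic_polynomial_def
    by (intro exI[of _ "{\<lambda>i. \<alpha> i + \<beta> i}"] exI[of _ "\<lambda>_. c \<alpha> * d \<beta>"])
      (auto simp: power_add prod.distrib algebra_simps)
  have "(\<lambda>z. p z * q z) = (\<lambda>z. \<Sum>\<alpha>\<in>M. \<Sum>\<beta>\<in>N. (c \<alpha> * (\<Prod>i\<in>UNIV. (z $ i) ^ \<alpha> i)) *
      (d \<beta> * (\<Prod>i\<in>UNIV. (z $ i) ^ \<beta> i)))"
    unfolding M(2) N(2) by (simp add: sum_product)
  then show ?thesis
    by (simp only:) (intro holomorphic_polynomial_sum monomial)
qed

lemma holomorphic_polynomial_power: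
  assumes "holomorphic_polynomial p"
  shows "holomorphic_polynomial (\<lambda>z. p z ^ k)"
  by (induction k) (auto intro: holomorphic_polynomial_const holomorphic_polynomial_mult assms)

lemma continuous_on_holomorphic_polynomial:
  assumes "holomorphic_polynomial p"
  shows "continuous_on S p"
  using assms unfolding holomorphic_polynomial_def by (auto intro!: continuous_intros)

text \<open>
  Membership of \<open>f\<close> in the closure of the holomorphic polynomials for uniform convergence on \<open>K\<close>.
  Only the values of \<open>f\<close> on \<open>K\<close> matter.
\<close>
definition poly_approximable :: "(complex ^ 'n) set \<Rightarrow> (complex ^ 'n \<Rightarrow> complex) \<Rightarrow> bool" where
  "poly_approximable K f \<longleftrightarrow>
     (\<forall>\<epsilon>>0. \<exists>p. holomorphic_polynomial p \<and> (\<forall>z\<in>K. norm (f z - p z) < \<epsilon>))"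

lemma poly_approximable_polynomial:
  "holomorphic_polynomial p \<Longrightarrow> poly_approximable K p"
  unfolding poly_approximable_def by (metis diff_self norm_zero)

lemma poly_approximable_limit:
  assumes "\<And>\<epsilon>. \<epsilon> > 0 \<Longrightarrow> \<exists>g. poly_approximable K g \<and> (\<forall>z\<in>K. norm (f z - g z) < \<epsilon>)"
  shows "poly_approximable K f"
  unfolding poly_approximable_def
proof (intro allI impI)
  fix \<epsilon> :: real assume "\<epsilon> > 0"
  then obtain g where g: "poly_approximable K g" "\<forall>z\<in>K. norm (f z - g z) < \<epsilon> / 2"
    using assms[of "\<epsilon> / 2"] by auto
  then obtain p where p: "holomorphic_polynomial p" "\<forall>z\<in>K. norm (g z - p z) < \<epsilon> / 2"
    using \<open>\<epsilon> > 0\<close> unfolding poly_approximable_def by (meson half_gt_zero)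
  have "norm (f z - p z) < \<epsilon>" if "z \<in> K" for z
    using norm_triangle_ineq[of "f z - g z" "g z - p z"] g(2) p(2) that by fastforce
  then show "\<exists>p. holomorphic_polynomial p \<and> (\<forall>z\<in>K. norm (f z - p z) < \<epsilon>)"
    using p(1) by blast
qed

lemma poly_approximable_add:
  assumes "poly_approximable K f" "poly_approximable K g"
  shows "poly_approximable K (\<lambda>z. f z + g z)"
  unfolding poly_approximable_def
proof (intro allI impI)
  fix \<epsilon> :: real assume "\<epsilon> > 0"
  then have "\<epsilon> / 2 > 0" by simp
  then obtain p q where p: "holomorphic_polynomial p" "\<forall>z\<in>K. norm (f z - p z) < \<epsilon> / 2"
    and q: "holomorphic_polynomial q" "\<forall>z\<in>K. norm (g z - q z) < \<epsilon> / 2"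
    using assms unfolding poly_approximable_def by meson
  have "norm (f z + g z - (p z + q z)) < \<epsilon>" if "z \<in> K" for z
    using norm_triangle_ineq[of "f z - p z" "g z - q z"] p(2) q(2) that
    by (fastforce simp: algebra_simps)
  then show "\<exists>p. holomorphic_polynomial p \<and> (\<forall>z\<in>K. norm (f z + g z - p z) < \<epsilon>)"
    using holomorphic_polynomial_add[OF p(1) q(1)] by blast
qed

lemma poly_approximable_mult_polynomial:
  assumes "compact K" "holomorphic_polynomial p" "poly_approximable K f"
  shows "poly_approximable K (\<lambda>z. p z * f z)"
  unfolding poly_approximable_def
proof (intro allI impI)
  fix \<epsilon> :: real assume "\<epsilon> > 0"
  have "bounded (p ` K)"
    using assms(1) continuous_on_holomorphic_polynomial[OF assms(2)]
    by (intro compact_imp_bounded compact_continuous_image)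
  then obtain B where B: "B > 0" "\<And>z. z \<in> K \<Longrightarrow> norm (p z) \<le> B"
    unfolding bounded_pos by auto
  then obtain q where q: "holomorphic_polynomial q" "\<forall>z\<in>K. norm (f z - q z) < \<epsilon> / B"
    using assms(3) \<open>\<epsilon> > 0\<close> unfolding poly_approximable_def by (meson divide_pos_pos)
  have "norm (p z * f z - p z * q z) < \<epsilon>" if "z \<in> K" for z
  proof -
    have "norm (p z * f z - p z * q z) = norm (p z) * norm (f z - q z)"
      by (simp add: norm_mult flip: right_diff_distrib)
    also have "\<dots> \<le> B * norm (f z - q z)"
      using B(2)[OF that] by (intro mult_right_mono) auto
    also have "\<dots> < B * (\<epsilon> / B)"
      using q(2) that B(1) by (intro mult_strict_left_mono) auto
    finally show ?thesis using B(1) by simp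
  qed
  then show "\<exists>r. holomorphic_polynomial r \<and> (\<forall>z\<in>K. norm (p z * f z - r z) < \<epsilon>)"
    using holomorphic_polynomial_mult[OF assms(2) q(1)] by blast
qed

lemma poly_approximable_sum:
  assumes "\<And>j. j \<in> J \<Longrightarrow> poly_approximable K (f j)"
  shows "poly_approximable K (\<lambda>z. \<Sum>j\<in>J. f j z)"
  using assms
  by (induction J rule: infinite_finite_induct)
    (auto intro: poly_approximable_polynomial holomorphic_polynomial_const poly_approximable_add)

section \<open>Analytic families of functions\<close>

text \<open>The remainder is dominated by a geometric series, by Cauchy's estimates on the circle of radius \<open>r\<close>.\<close>
lemma taylor_remainder_bound:
  fixes g :: "complex \<Rightarrow> complex"
  assumes hol: "g holomorphic_on ball 0 R" and bound: "\<And>h. norm h < R \<Longrightarrow> norm (g h) \<le> M"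
    and r: "r < R" and h: "norm h < r"
  shows "norm (g h - (\<Sum>j<k. (deriv ^^ j) g 0 / fact j * h ^ j))
           \<le> M * (norm h / r) ^ k / (1 - norm h / r)"
proof -
  define a where "a j = (deriv ^^ j) g 0 / fact j" for j
  have "r > 0" using h norm_ge_zero[of h] by linarith
  have a_bound: "norm (a j) \<le> M / r ^ j" for j
  proof -
    have "norm ((deriv ^^ j) g 0) \<le> fact j * M / r ^ j"
    proof (rule Cauchy_inequality)
      show "g holomorphic_on ball 0 r" "continuous_on (cball 0 r) g"
        using hol r by (auto intro!: holomorphic_on_imp_continuous_on elim!: holomorphic_on_subset)
    qed (use r bound \<open>r > 0\<close> in auto)
    then show ?thesis by (simp add: a_def norm_divide field_simps)
  qed
  have "(\<lambda>j. a j * h ^ j) sums g h"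
    using holomorphic_power_series[OF hol, of h] h r by (simp add: a_def)
  then have "(\<lambda>j. a (j + k) * h ^ (j + k)) sums (g h - (\<Sum>j<k. a j * h ^ j))"
    by (rule sums_split_initial_segment)
  moreover have "(\<lambda>j. M * (norm h / r) ^ k * (norm h / r) ^ j) sums
      (M * (norm h / r) ^ k * (1 / (1 - norm h / r)))"
    using h \<open>r > 0\<close> by (intro sums_mult geometric_sums) auto
  moreover have "norm (a (j + k) * h ^ (j + k)) \<le> M * (norm h / r) ^ k * (norm h / r) ^ j" for j
    using mult_right_mono[OF a_bound[of "j + k"], of "norm h ^ (j + k)"]
    by (simp add: norm_mult norm_power power_divide power_add field_simps)
  ultimately have "norm (g h - (\<Sum>j<k. a j * h ^ j)) \<le>
      M * (norm h / r) ^ k * (1 / (1 - norm h / r))"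
    by (rule norm_sums_le)
  then show ?thesis by (simp add: a_def)
qed

text \<open>
  A family that depends analytically on \<open>h\<close> and consists of approximable functions for small real
  \<open>h > 0\<close> has approximable Taylor coefficients at \<open>h = 0\<close>: once the coefficients below \<open>k\<close> are
  known to be approximable, the \<open>k\<close>-th one is the uniform limit, as \<open>h\<close> decreases to \<open>0\<close>, of the quotients of
  the \<open>k\<close>-th remainder by \<open>h ^ k\<close>.
\<close>
lemma poly_approximable_taylor_coeff:
  fixes F :: "complex \<Rightarrow> complex ^ 'n \<Rightarrow> complex"
  assumes "compact K" and "R > 0"
    and hol: "\<And>z. z \<in> K \<Longrightarrow> (\<lambda>h. F h z) holomorphic_on ball 0 R"
    and bound: "\<And>h z. norm h < R \<Longrightarrow> z \<in> K \<Longrightarrow> norm (F h z) \<le> M"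
    and "\<delta> > 0" and near: "\<And>h. 0 < h \<Longrightarrow> h < \<delta> \<Longrightarrow> poly_approximable K (F (of_real h))"
  shows "poly_approximable K (\<lambda>z. (deriv ^^ k) (\<lambda>h. F h z) 0 / fact k)"
proof (induction k rule: less_induct)
  case (less k)
  define a where "a j z = (deriv ^^ j) (\<lambda>h. F h z) 0 / fact j" for j z
  define r where "r = R / 2"
  have r: "0 < r" "r < R" using \<open>R > 0\<close> by (auto simp: r_def)
  show ?case
  proof (rule poly_approximable_limit)
    fix \<epsilon> :: real assume "\<epsilon> > 0"
    define B where "B = \<bar>M\<bar> + 1"
    have "B > 0" by (simp add: B_def)
    have rk: "r ^ Suc k > 0" using r by simp
    \<comment> \<open>\<open>h \<le> r / 2\<close> keeps the ratio of the geometric series at most \<open>1/2\<close>. The last bound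
       makes the error \<open>2 * B * h / r ^ Suc k\<close> at most \<open>\<epsilon> / 2\<close>.\<close>
    define h where "h = min (\<delta> / 2) (min (r / 2) (\<epsilon> * r ^ Suc k / (4 * B)))"
    have pos: "\<epsilon> * r ^ Suc k / (4 * B) > 0"
      using rk \<open>\<epsilon> > 0\<close> \<open>B > 0\<close> by simp
    have h: "0 < h" "h < \<delta>" "h \<le> r / 2" "h \<le> \<epsilon> * r ^ Suc k / (4 * B)"
      using \<open>\<delta> > 0\<close> r(1) pos by (auto simp: h_def)
    define G where "G z = (1 / of_real h ^ k) * F (of_real h) z +
        (\<Sum>j<k. (- (of_real h ^ j / of_real h ^ k)) * a j z)" for z
    have "poly_approximable K G"
      unfolding G_def
      by (intro poly_approximable_add poly_approximable_sum poly_approximable_mult_polynomial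
          holomorphic_polynomial_const near h \<open>compact K\<close>)
        (use less in \<open>auto simp: a_def\<close>)
    moreover have "norm (a k z - G z) < \<epsilon>" if "z \<in> K" for z
    proof -
      have "a k z - G z = - (F (of_real h) z - (\<Sum>j<Suc k. a j z * of_real h ^ j)) / of_real h ^ k"
        using h(1)
        by (simp add: G_def diff_divide_distrib add_divide_distrib sum_negf sum_divide_distrib mult.commute)
      then have "norm (a k z - G z) =
          norm (F (of_real h) z - (\<Sum>j<Suc k. a j z * of_real h ^ j)) / h ^ k"
        using h(1) by (simp add: norm_divide norm_power norm_minus_commute)
      also have "\<dots> \<le> (M * (h / r) ^ Suc k / (1 - h / r)) / h ^ k"
        using taylor_remainder_bound[OF hol[OF that] bound[OF _ that] r(2), of "of_real h" "Suc k"]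
          h r(1) by (intro divide_right_mono) (auto simp: a_def)
      also have "\<dots> \<le> (B * (h / r) ^ Suc k / (1 / 2)) / h ^ k"
        using h r(1) unfolding B_def
        by (intro divide_right_mono frac_le mult_mono mult_right_mono) (auto simp: field_simps)
      also have "\<dots> = 2 * B * h / r ^ Suc k"
        using h(1) r(1) by (simp add: field_simps)
      also have "\<dots> \<le> \<epsilon> / 2"
        using h(4) rk \<open>B > 0\<close> by (simp add: field_simps)
      also have "\<dots> < \<epsilon>" using \<open>\<epsilon> > 0\<close> by simp
      finally show ?thesis .
    qed
    ultimately show "\<exists>g. poly_approximable K g \<and>
        (\<forall>z\<in>K. norm ((deriv ^^ k) (\<lambda>h. F h z) 0 / fact k - g z) < \<epsilon>)"
      unfolding a_def by blast
  qed
qed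

text \<open>
  Summing the Taylor series recovers the family on the whole disc. The parameter may be a
  polynomial \<open>\<phi>\<close> in \<open>z\<close>: a constant \<open>\<phi>\<close> gives continuation in the parameter, and a coordinate
  \<open>\<phi>\<close> expands a function of several variables in powers of that coordinate.
\<close>
lemma poly_approximable_continuation:
  fixes F :: "complex \<Rightarrow> complex ^ 'n \<Rightarrow> complex"
  assumes "compact K" and "R > 0"
    and hol: "\<And>z. z \<in> K \<Longrightarrow> (\<lambda>h. F h z) holomorphic_on ball 0 R"
    and bound: "\<And>h z. norm h < R \<Longrightarrow> z \<in> K \<Longrightarrow> norm (F h z) \<le> M"
    and "\<delta> > 0" and near: "\<And>h. 0 < h \<Longrightarrow> h < \<delta> \<Longrightarrow> poly_approximable K (F (of_real h))"
    and \<phi>: "holomorphic_polynomial \<phi>" and s: "s < R" "\<And>z. z \<in> K \<Longrightarrow> norm (\<phi> z) \<le> s"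
  shows "poly_approximable K (\<lambda>z. F (\<phi> z) z)"
proof (cases "K = {}")
  case True
  then show ?thesis
    using holomorphic_polynomial_const by (auto simp: poly_approximable_def)
next
  case False
  then have "s \<ge> 0" using s(2) norm_ge_zero order_trans by blast
  define r where "r = (s + R) / 2"
  have r: "s < r" "r < R" "r > 0" using s(1) \<open>s \<ge> 0\<close> by (auto simp: r_def)
  have M: "M \<ge> 0"
  proof -
    obtain z where "z \<in> K" using False by blast
    then have "norm (F 0 z) \<le> M" using bound \<open>R > 0\<close> by auto
    then show ?thesis using norm_ge_zero order_trans by blast
  qed
  show ?thesis
  proof (rule poly_approximable_limit)
    fix \<epsilon> :: real assume "\<epsilon> > 0"
    have "(\<lambda>k. M * (s / r) ^ k / (1 - s / r)) \<longlonglongrightarrow> M * 0 / (1 - s / r)"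
      using r \<open>s \<ge> 0\<close> by (intro tendsto_intros LIMSEQ_realpow_zero) auto
    then have "\<forall>\<^sub>F k in sequentially. M * (s / r) ^ k / (1 - s / r) < \<epsilon>"
      using \<open>\<epsilon> > 0\<close> by (intro order_tendstoD(2)) auto
    then obtain k where k: "M * (s / r) ^ k / (1 - s / r) < \<epsilon>"
      using eventually_sequentially by auto
    define G where "G z = (\<Sum>j<k. \<phi> z ^ j * ((deriv ^^ j) (\<lambda>h. F h z) 0 / fact j))" for z
    have "poly_approximable K G"
      unfolding G_def
      by (intro poly_approximable_sum poly_approximable_mult_polynomial
          poly_approximable_taylor_coeff[OF \<open>compact K\<close> \<open>R > 0\<close> hol bound \<open>\<delta> > 0\<close> near]
          holomorphic_polynomial_power \<phi> \<open>compact K\<close>)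
    moreover have "norm (F (\<phi> z) z - G z) < \<epsilon>" if "z \<in> K" for z
    proof -
      have le: "norm (\<phi> z) \<le> s" using s(2) that by blast
      have "norm (F (\<phi> z) z - G z) \<le> M * (norm (\<phi> z) / r) ^ k / (1 - norm (\<phi> z) / r)"
        using taylor_remainder_bound[OF hol[OF that] bound[OF _ that] r(2), of "\<phi> z" k] le r
        by (auto simp: G_def mult.commute)
      also have "\<dots> \<le> M * (s / r) ^ k / (1 - s / r)"
        using le r M \<open>s \<ge> 0\<close>
        by (intro frac_le mult_left_mono power_mono divide_right_mono mult_nonneg_nonneg)
          (auto intro: divide_right_mono)
      finally show ?thesis using k by simp
    qed
    ultimately show "\<exists>g. poly_approximable K g \<and> (\<forall>z\<in>K. norm (F (\<phi> z) z - g z) < \<epsilon>)"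
      by blast
  qed
qed

section \<open>Approximation on polydiscs\<close>

lemma has_derivative_vecI:
  fixes \<gamma> :: "'a :: euclidean_space \<Rightarrow> 'b :: euclidean_space ^ 'n"
  assumes "\<And>i. ((\<lambda>t. \<gamma> t $ i) has_derivative (\<lambda>k. D k $ i)) (at t)"
  shows "(\<gamma> has_derivative D) (at t)"
proof -
  have "linear (\<lambda>k. D k $ i)" for i
    using assms[of i] by (rule has_derivative_linear)
  from linear_add[OF this] linear_cmul[OF this] have "linear D"
    by (intro linearI) (simp_all add: vec_eq_iff)
  then have "bounded_linear D" by (simp add: linear_conv_bounded_linear)
  moreover have "((\<lambda>y. (\<gamma> y - \<gamma> t - D (y - t)) /\<^sub>R norm (y - t)) \<longlongrightarrow> 0) (at t)"
    using assms by (intro vec_tendstoI) (simp add: has_derivative_at_within)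
  ultimately show ?thesis by (simp add: has_derivative_at_within)
qed

lemma holomorphic_several_continuous_on:
  "holomorphic_several f U \<Longrightarrow> continuous_on U f"
  unfolding holomorphic_several_def
  by (meson continuous_at_imp_continuous_on has_derivative_continuous)

lemma holomorphic_several_comp_curve:
  fixes \<gamma> :: "complex \<Rightarrow> complex ^ 'n"
  assumes f: "holomorphic_several f U" and "open S"
    and \<gamma>: "\<And>i. (\<lambda>t. \<gamma> t $ i) holomorphic_on S" and sub: "\<And>t. t \<in> S \<Longrightarrow> \<gamma> t \<in> U"
  shows "(\<lambda>t. f (\<gamma> t)) holomorphic_on S"
proof -
  have "(\<lambda>t. f (\<gamma> t)) field_differentiable at t" if "t \<in> S" for t
  proof -
    define v where "v = (\<chi> i. deriv (\<lambda>t. \<gamma> t $ i) t)"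
    have "((\<lambda>t. \<gamma> t $ i) has_derivative (\<lambda>k. (k *s v) $ i)) (at t)" for i
      using holomorphic_derivI[OF \<gamma> \<open>open S\<close> that, of i UNIV]
      by (simp add: v_def has_field_derivative_def mult_commute_abs)
    then have "(\<gamma> has_derivative (\<lambda>k. k *s v)) (at t)"
      by (rule has_derivative_vecI)
    moreover obtain D where D: "(f has_derivative D) (at (\<gamma> t))" "\<And>c v. D (c *s v) = c * D v"
      using f sub[OF \<open>t \<in> S\<close>] unfolding holomorphic_several_def by blast
    ultimately have "((\<lambda>t. f (\<gamma> t)) has_derivative (\<lambda>k. D (k *s v))) (at t)"
      using has_derivative_compose by blast
    then have "((\<lambda>t. f (\<gamma> t)) has_field_derivative D v) (at t)"
      by (simp add: D(2) has_field_derivative_def mult_commute_abs)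
    then show ?thesis by (auto simp: field_differentiable_def)
  qed
  then show ?thesis
    by (auto simp: holomorphic_on_def intro: field_differentiable_at_within)
qed

lemma norm_le_of_coord_le:
  fixes z :: "complex ^ 'n"
  assumes "\<And>i. norm (z $ i) \<le> R"
  shows "norm z \<le> of_nat CARD('n) * R"
proof -
  have "norm z \<le> (\<Sum>i\<in>UNIV. norm (z $ i))"
    by (simp add: norm_vec_def L2_set_le_sum)
  also have "\<dots> \<le> of_nat CARD('n) * R"
    using assms by (intro sum_bounded_above) auto
  finally show ?thesis .
qed

text \<open>
  The case of the Oka-Weil theorem that is needed. The variables outside a set \<open>I\<close> of coordinates are
  frozen at the values \<open>w\<close>, and the coordinates are released one by one.
\<close>
lemma poly_approximable_on_polydisc:
  fixes f :: "complex ^ 'n \<Rightarrow> complex"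
  assumes "compact K" and f: "holomorphic_several f U"
    and U: "\<And>z. (\<And>i. norm (z $ i) \<le> R) \<Longrightarrow> z \<in> U"
    and s: "s < R" "0 \<le> s" "\<And>z i. z \<in> K \<Longrightarrow> norm (z $ i) \<le> s"
  shows "poly_approximable K f"
proof -
  define D where "D = {z :: complex ^ 'n. \<forall>i. norm (z $ i) \<le> R}"
  have "D \<subseteq> U" using U by (auto simp: D_def)
  have "R > 0" using s by linarith
  have "compact D"
  proof -
    have "closed D"
      unfolding D_def by (intro closed_Collect_all closed_Collect_le continuous_intros)
    moreover have "bounded D"
      unfolding bounded_iff D_def using norm_le_of_coord_le by blast
    ultimately show ?thesis by (simp add: compact_eq_bounded_closed)
  qed
  then have "bounded (f ` D)"
    using holomorphic_several_continuous_on[OF f] \<open>D \<subseteq> U\<close>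
    by (meson compact_continuous_image compact_imp_bounded continuous_on_subset)
  then obtain M where M: "\<And>z. z \<in> D \<Longrightarrow> norm (f z) \<le> M"
    unfolding bounded_iff by auto
  have partial: "\<forall>w\<in>D. poly_approximable K (\<lambda>z. f (\<chi> j. if j \<in> I then z $ j else w $ j))"
    if "finite I" for I
    using that
  proof (induction I)
    case empty
    show ?case by (simp add: poly_approximable_polynomial holomorphic_polynomial_const)
  next
    case (insert i I)
    show ?case
    proof
      fix w assume "w \<in> D"
      define u where
        "u h z = (\<chi> j. if j = i then h else if j \<in> I then z $ j else w $ j)"
        for h and z :: "complex ^ 'n"
      have u_D: "u h z \<in> D" if "norm h < R" "z \<in> K" for h z
      proof -
        have "norm (z $ j) \<le> R" "norm (w $ j) \<le> R" for j
          using s(1) s(3)[OF that(2), of j] \<open>w \<in> D\<close> by (auto simp: D_def)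
        then show ?thesis using that(1) by (simp add: u_def D_def)
      qed
      have "poly_approximable K (\<lambda>z. f (u (z $ i) z))"
      proof (rule poly_approximable_continuation[where F = "\<lambda>h z. f (u h z)" and \<delta> = R and M = M])
        fix z assume "z \<in> K"
        show "(\<lambda>h. f (u h z)) holomorphic_on ball 0 R"
        proof (rule holomorphic_several_comp_curve[OF f])
          show "(\<lambda>h. u h z $ j) holomorphic_on ball 0 R" for j
            by (cases "j = i") (auto simp: u_def)
          show "u h z \<in> U" if "h \<in> ball 0 R" for h
            using u_D[of h z] that \<open>z \<in> K\<close> \<open>D \<subseteq> U\<close> by auto
        qed auto
      next
        fix h :: real assume "0 < h" "h < R"
        define w' where "w' = (\<chi> j. if j = i then complex_of_real h else w $ j)"
        have "w' \<in> D" using \<open>0 < h\<close> \<open>h < R\<close> \<open>w \<in> D\<close> by (auto simp: w'_def D_def)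
        moreover have "(\<chi> j. if j \<in> I then z $ j else w' $ j) = u (of_real h) z" for z
          using insert.hyps by (auto simp: vec_eq_iff w'_def u_def)
        ultimately show "poly_approximable K (\<lambda>z. f (u (of_real h) z))"
          using insert.IH by fastforce
      qed (use \<open>compact K\<close> \<open>R > 0\<close> s M u_D holomorphic_polynomial_coord in auto)
      moreover have "u (z $ i) z = (\<chi> j. if j \<in> insert i I then z $ j else w $ j)" for z
        by (auto simp: vec_eq_iff u_def)
      ultimately show "poly_approximable K (\<lambda>z. f (\<chi> j. if j \<in> insert i I then z $ j else w $ j))"
        by simp
    qed
  qed
  have "0 \<in> D" using \<open>R > 0\<close> by (simp add: D_def)
  then have "poly_approximable K (\<lambda>z. f (\<chi> j. if j \<in> UNIV then z $ j else 0 $ j))"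
    using partial[OF finite, of UNIV] by blast
  then show ?thesis by simp
qed

section \<open>Propagation along a flow\<close>

text \<open>
  Only the entire dependence of the matrices \<open>X t\<close> on \<open>t\<close> is used, not the group law.
\<close>
lemma poly_approximable_flow_left_extension:
  fixes X :: "complex \<Rightarrow> complex ^ 'n ^ 'n"
  assumes "open \<Omega>" and f: "holomorphic_several f \<Omega>" and "compact K"
    and hol: "\<And>i j. (\<lambda>t. X t $ i $ j) holomorphic_on UNIV"
    and stay: "\<And>z. z \<in> K \<Longrightarrow> X (of_real t0) *v z \<in> \<Omega>"
    and after: "\<And>t. t > t0 \<Longrightarrow> poly_approximable K (\<lambda>z. f (X (of_real t) *v z))"
  shows "\<exists>\<rho>>0. \<forall>h. \<bar>h\<bar> < \<rho> \<longrightarrow> poly_approximable K (\<lambda>z. f (X (of_real (t0 + h)) *v z))"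
proof -
  define u where "u h z = X (of_real t0 + h) *v z" for h z
  have contX: "continuous_on UNIV (\<lambda>t. X t $ i $ j)" for i j
    using hol holomorphic_on_imp_continuous_on by blast
  have cont_u: "continuous_on (cball 0 1 \<times> K) (\<lambda>(h, z). u h z)"
    unfolding u_def matrix_vector_mult_def case_prod_unfold
    by (intro continuous_intros continuous_on_compose2[OF contX]) auto
  have "compact ((\<lambda>z. u 0 z) ` K)"
    unfolding u_def using \<open>compact K\<close>
    by (intro compact_continuous_image linear_continuous_on)
      (auto simp: linear_conv_bounded_linear[symmetric] matrix_vector_mul_linear)
  moreover have "(\<lambda>z. u 0 z) ` K \<subseteq> \<Omega>"
    using stay by (auto simp: u_def)
  ultimately obtain e where e: "e > 0" "(\<Union>y\<in>(\<lambda>z. u 0 z) ` K. ball y e) \<subseteq> \<Omega>"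
    using compact_subset_open_imp_ball_epsilon_subset[OF _ \<open>open \<Omega>\<close>] by blast
  \<comment> \<open>One radius \<open>R\<close> of complex times serves all points of \<open>K\<close>.\<close>
  have "uniformly_continuous_on (cball 0 1 \<times> K) (\<lambda>(h, z). u h z)"
    using cont_u \<open>compact K\<close> by (intro compact_uniformly_continuous compact_Times) auto
  then obtain d where d: "d > 0" "\<And>p q. p \<in> cball 0 1 \<times> K \<Longrightarrow> q \<in> cball 0 1 \<times> K \<Longrightarrow>
      dist q p < d \<Longrightarrow> dist (case_prod u q) (case_prod u p) < e"
    using e(1) unfolding uniformly_continuous_on_def by blast
  define R where "R = min (d / 2) 1"
  have R: "0 < R" "R < d" "R \<le> 1" using d(1) by (auto simp: R_def)
  have u_\<Omega>: "u h z \<in> \<Omega>" if "norm h \<le> R" "z \<in> K" for h z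
  proof -
    have "dist (u 0 z) (u h z) < e"
      using d(2)[of "(h, z)" "(0, z)"] that R by (auto simp: dist_prod_def)
    then have "u h z \<in> ball (u 0 z) e" by simp
    then show ?thesis using e(2) that(2) by blast
  qed
  have "bounded ((\<lambda>(h, z). f (u h z)) ` (cball 0 R \<times> K))"
  proof (intro compact_imp_bounded compact_continuous_image)
    have "continuous_on (cball 0 R \<times> K) (\<lambda>(h, z). u h z)"
      using cont_u by (rule continuous_on_subset) (use R in auto)
    then show "continuous_on (cball 0 R \<times> K) (\<lambda>(h, z). f (u h z))"
      unfolding case_prod_unfold
      by (intro continuous_on_compose2[OF holomorphic_several_continuous_on[OF f]])
        (use u_\<Omega> in auto)
    show "compact (cball (0 :: complex) R \<times> K)"
      using \<open>compact K\<close> by (intro compact_Times compact_cball)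
  qed
  then obtain M where M: "\<And>h z. norm h \<le> R \<Longrightarrow> z \<in> K \<Longrightarrow> norm (f (u h z)) \<le> M"
    unfolding bounded_iff by force
  have "poly_approximable K (\<lambda>z. f (u (of_real h) z))" if "\<bar>h\<bar> < R" for h
  proof (rule poly_approximable_continuation[where F = "\<lambda>h z. f (u h z)" and R = R and \<delta> = 1
        and M = M and s = "\<bar>h\<bar>"])
    fix z assume "z \<in> K"
    show "(\<lambda>h. f (u h z)) holomorphic_on ball 0 R"
    proof (rule holomorphic_several_comp_curve[OF f])
      have X_hol: "(\<lambda>h. X (of_real t0 + h) $ i $ j) holomorphic_on ball 0 R" for i j
      proof -
        have "(\<lambda>h. of_real t0 + h) holomorphic_on ball 0 R"
          by (intro holomorphic_on_add holomorphic_on_const holomorphic_on_ident)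
        from holomorphic_on_compose_gen[OF this hol[of i j]] show ?thesis by (simp add: o_def)
      qed
      show "(\<lambda>h. u h z $ i) holomorphic_on ball 0 R" for i
        unfolding u_def matrix_vector_mult_def vec_lambda_beta
        by (intro holomorphic_on_sum holomorphic_on_mult holomorphic_on_const X_hol)
      show "u h z \<in> \<Omega>" if "h \<in> ball 0 R" for h
        using u_\<Omega>[of h z] that \<open>z \<in> K\<close> by auto
    qed auto
  next
    show "poly_approximable K (\<lambda>z. f (u (of_real h') z))" if "0 < h'" "h' < 1" for h' :: real
      using after[of "t0 + h'"] that by (simp add: u_def)
    show "norm (f (u h' z)) \<le> M" if "norm h' < R" "z \<in> K" for h' z
      using M that by simp
  qed (use \<open>compact K\<close> R(1) that in \<open>simp_all add: holomorphic_polynomial_const\<close>)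
  then show ?thesis
    using R(1) by (intro exI[of _ R]) (simp add: u_def)
qed

text \<open>
  The infimum of the times from which on \<open>z \<mapsto> f (X t z)\<close> stays approximable is \<open>0\<close>, since otherwise
  the previous lemma would lower it. The same lemma at \<open>t0 = 0\<close> includes the time \<open>0\<close> itself.
\<close>
lemma poly_approximable_of_entire_matrix_flow:
  fixes X :: "complex \<Rightarrow> complex ^ 'n ^ 'n"
  assumes "open \<Omega>" and f: "holomorphic_several f \<Omega>" and "compact K"
    and hol: "\<And>i j. (\<lambda>t. X t $ i $ j) holomorphic_on UNIV"
    and X0: "X 0 = mat 1"
    and stay: "\<And>t z. 0 \<le> t \<Longrightarrow> z \<in> K \<Longrightarrow> X (of_real t) *v z \<in> \<Omega>"
    and swallow: "\<And>r. \<exists>T. \<forall>t\<ge>T. \<forall>z\<in>cball 0 r. X (of_real t) *v z \<in> \<Omega>"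
  shows "poly_approximable K f"
proof -
  define S where "S = {t. t \<ge> 0 \<and> (\<forall>s\<ge>t. poly_approximable K (\<lambda>z. f (X (of_real s) *v z)))}"
  have "S \<noteq> {}"
  proof -
    obtain s where s: "s > 0" "\<And>z. z \<in> K \<Longrightarrow> norm z \<le> s"
      using compact_imp_bounded[OF \<open>compact K\<close>] unfolding bounded_pos by auto
    \<comment> \<open>A ball of radius \<open>r\<close> contains the polydisc of radius \<open>s + 1\<close>.\<close>
    define r where "r = of_nat CARD('n) * (s + 1)"
    obtain T where T: "\<forall>t\<ge>T. \<forall>z\<in>cball 0 r. X (of_real t) *v z \<in> \<Omega>"
      using swallow[of r] by (rule exE)
    have "poly_approximable K (\<lambda>z. f (X (of_real t) *v z))" if "t \<ge> T" for t
    proof (rule poly_approximable_on_polydisc[OF \<open>compact K\<close>, where s = s and R = "s + 1"])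
      show "holomorphic_several (\<lambda>z. f (X (of_real t) *v z)) {z. X (of_real t) *v z \<in> \<Omega>}"
        unfolding holomorphic_several_def
      proof clarify
        fix z assume "X (of_real t) *v z \<in> \<Omega>"
        then obtain D where D: "(f has_derivative D) (at (X (of_real t) *v z))"
          "\<And>c v. D (c *s v) = c * D v"
          using f unfolding holomorphic_several_def by blast
        have "((*v) (X (of_real t)) has_derivative (*v) (X (of_real t))) (at z)"
          by (intro linear_imp_has_derivative matrix_vector_mul_linear)
        from has_derivative_compose[OF this D(1)]
        show "\<exists>D. ((\<lambda>z. f (X (of_real t) *v z)) has_derivative D) (at z) \<and>
            (\<forall>c v. D (c *s v) = c * D v)"
          by (intro exI[of _ "\<lambda>v. D (X (of_real t) *v v)"]) (simp add: vec.scale D(2))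
      qed
      show "z \<in> {z. X (of_real t) *v z \<in> \<Omega>}" if "\<And>i. norm (z $ i) \<le> s + 1" for z
      proof -
        have "z \<in> cball 0 r" using norm_le_of_coord_le[OF that] by (simp add: r_def)
        then show ?thesis using T \<open>t \<ge> T\<close> by blast
      qed
      show "norm (z $ i) \<le> s" if "z \<in> K" for z i
        using s(2)[OF that] Finite_Cartesian_Product.norm_nth_le[of z i] by linarith
    qed (use s in auto)
    then have "max T 0 \<in> S" by (simp add: S_def)
    then show ?thesis by blast
  qed
  have step: "\<exists>\<rho>>0. \<forall>h. \<bar>h\<bar> < \<rho> \<longrightarrow> poly_approximable K (\<lambda>z. f (X (of_real (t0 + h)) *v z))"
    if "t0 \<ge> 0" and after: "\<And>t. t > t0 \<Longrightarrow> poly_approximable K (\<lambda>z. f (X (of_real t) *v z))" for t0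
    using that by (intro poly_approximable_flow_left_extension[OF assms(1-3) hol] stay) auto
  define t0 where "t0 = Inf S"
  have bdd: "bdd_below S" by (auto simp: S_def bdd_below_def)
  have "t0 \<ge> 0" unfolding t0_def using \<open>S \<noteq> {}\<close> by (rule cInf_greatest) (simp add: S_def)
  have after: "poly_approximable K (\<lambda>z. f (X (of_real t) *v z))" if "t > t0" for t
  proof -
    obtain s where "s \<in> S" "s < t"
      using cInf_lessD[OF \<open>S \<noteq> {}\<close>] \<open>t > t0\<close> unfolding t0_def by blast
    then show ?thesis by (auto simp: S_def)
  qed
  obtain \<rho> where \<rho>: "\<rho> > 0"
    "\<And>h. \<bar>h\<bar> < \<rho> \<Longrightarrow> poly_approximable K (\<lambda>z. f (X (of_real (t0 + h)) *v z))"
    using step[OF \<open>t0 \<ge> 0\<close> after] by blast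
  have "t0 = 0"
  proof (rule ccontr)
    assume "t0 \<noteq> 0"
    define t1 where "t1 = max 0 (t0 - \<rho> / 2)"
    have "poly_approximable K (\<lambda>z. f (X (of_real s) *v z))" if "s \<ge> t1" for s
      using after[of s] \<rho>(2)[of "s - t0"] \<rho>(1) that by (cases "s > t0") (auto simp: t1_def)
    then have "t1 \<in> S" by (auto simp: S_def t1_def)
    then have "t0 \<le> t1" unfolding t0_def using bdd by (rule cInf_lower)
    then show False using \<open>t0 \<ge> 0\<close> \<open>t0 \<noteq> 0\<close> \<rho>(1) by (auto simp: t1_def)
  qed
  then show ?thesis using \<rho>(2)[of 0] \<rho>(1) by (simp add: X0)
qed

section \<open>Polynomials acting on vectors\<close>

lemma matrix_power_vec: "matrix_power A k *v v = ((*v) A ^^ k) v"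
  by (induction k) (simp_all add: matrix_power_def matrix_vector_mul_assoc[symmetric])

lemma matrix_power_vec_mono:
  assumes "matrix_power A k *v v = 0" "k \<le> m"
  shows "matrix_power A m *v v = 0"
proof -
  have "matrix_power A m *v v = matrix_power A (m - k) *v (matrix_power A k *v v)"
    using assms(2) by (simp add: matrix_power_vec flip: funpow_add[THEN fun_cong, simplified o_apply])
  then show ?thesis using assms(1) by simp
qed

lemma mat_vec: "mat l *v v = l *s v"
  by (simp add: vec_eq_iff matrix_vector_mult_def mat_def if_distrib[of "\<lambda>a. a * _"] cong: if_cong)

lemma shifted_matrix_vec:
  fixes A :: "'a :: comm_ring_1 ^ 'n ^ 'n"
  shows "(A - mat l) *v v = A *v v - l *s v"
  using matrix_vector_mult_add_rdistrib[of "A - mat l" "mat l" v] by (simp add: mat_vec)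

text \<open>
  The action of \<open>p(A)\<close> on \<open>v\<close>. This makes the space a module over the polynomial ring. The ring operations
  on matrices do not provide \<open>p(A)\<close> directly, as their product is componentwise.
\<close>
definition poly_act :: "complex ^ 'n ^ 'n \<Rightarrow> complex poly \<Rightarrow> complex ^ 'n \<Rightarrow> complex ^ 'n" where
  "poly_act A p v = (\<Sum>i\<le>degree p. coeff p i *s (matrix_power A i *v v))"

lemma poly_act_eq_sum:
  assumes "degree p \<le> N"
  shows "poly_act A p v = (\<Sum>i\<le>N. coeff p i *s (matrix_power A i *v v))"
  unfolding poly_act_def using assms
  by (intro sum.mono_neutral_left) (auto simp: coeff_eq_0)

lemma poly_act_0 [simp]: "poly_act A 0 v = 0"
  by (simp add: poly_act_def)

lemma poly_act_pCons: "poly_act A (pCons a p) v = a *s v + A *v poly_act A p v"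
proof -
  have "poly_act A (pCons a p) v
      = (\<Sum>i\<le>Suc (degree p). coeff (pCons a p) i *s (matrix_power A i *v v))"
    by (intro poly_act_eq_sum degree_pCons_le)
  also have "\<dots> = a *s v + (\<Sum>i\<le>degree p. coeff p i *s (A *v (matrix_power A i *v v)))"
    by (simp add: sum.atMost_Suc_shift matrix_power_vec del: sum.atMost_Suc)
  also have "(\<Sum>i\<le>degree p. coeff p i *s (A *v (matrix_power A i *v v))) = A *v poly_act A p v"
    by (simp add: poly_act_def vec.sum vec.scale)
  finally show ?thesis .
qed

lemma poly_act_1 [simp]: "poly_act A 1 v = v"
  by (simp add: one_pCons poly_act_pCons)

lemma poly_act_add: "poly_act A (p + q) v = poly_act A p v + poly_act A q v"
proof -
  define N where "N = max (degree p) (degree q)"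
  have "degree p \<le> N" "degree q \<le> N" "degree (p + q) \<le> N"
    by (auto simp: N_def degree_add_le_max)
  then show ?thesis
    by (simp add: poly_act_eq_sum[of _ N] sum.distrib vec.scale_left_distrib)
qed

lemma poly_act_smult: "poly_act A (Polynomial.smult c p) v = c *s poly_act A p v"
  by (simp add: poly_act_eq_sum[of "Polynomial.smult c p" "degree p"] poly_act_def vec.scale_sum_right)

lemma poly_act_mult: "poly_act A (p * q) v = poly_act A p (poly_act A q v)"
  by (induction p) (simp_all add: poly_act_pCons poly_act_add poly_act_smult)

lemma poly_act_commute: "poly_act A p (poly_act A q v) = poly_act A q (poly_act A p v)"
  by (metis poly_act_mult mult.commute)

lemma poly_act_vec_add: "poly_act A p (v + w) = poly_act A p v + poly_act A p w"
  by (simp add: poly_act_def sum.distrib vec.add vec.scale_right_distrib)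

lemma poly_act_vec_scale: "poly_act A p (c *s v) = c *s poly_act A p v"
  by (simp add: poly_act_def vec.scale_sum_right vec.scale mult.commute)

lemma poly_act_zero [simp]: "poly_act A p 0 = 0"
  by (simp add: poly_act_def)

lemma poly_act_linear: "poly_act A [:- l, 1:] v = (A - mat l) *v v"
  by (simp add: poly_act_pCons shifted_matrix_vec vec.scale_minus_left)

lemma poly_act_linear_power: "poly_act A ([:- l, 1:] ^ k) v = matrix_power (A - mat l) k *v v"
  by (induction k)
    (simp_all only: power_Suc power_0 poly_act_mult poly_act_linear poly_act_1 matrix_power_vec
      funpow.simps o_apply id_apply)

section \<open>Spectral subspaces\<close>

text \<open>
  The sum of the generalized eigenspaces for the eigenvalues in \<open>S\<close>. The stable and the center-unstable subspace
  are the cases of the open left and the closed right half-plane.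
\<close>
definition spectral_subspace :: "complex ^ 'n ^ 'n \<Rightarrow> complex set \<Rightarrow> (complex ^ 'n) set" where
  "spectral_subspace A S = vec.span (\<Union>l\<in>{l \<in> eigenvalues A. l \<in> S}. gen_eigenspace A l)"

lemma subspace_spectral_subspace: "vec.subspace (spectral_subspace A S)"
  by (simp add: spectral_subspace_def)

lemma spectral_subspace_annihilator:
  assumes "v \<in> spectral_subspace A S"
  shows "\<exists>p. p \<noteq> 0 \<and> (\<forall>x. poly p x = 0 \<longrightarrow> x \<in> S) \<and> poly_act A p v = 0"
  using assms unfolding spectral_subspace_def
proof (induction rule: vec.span_induct_alt)
  case base
  show ?case by (intro exI[of _ 1]) simp
next
  case (step c x y)
  then obtain l k where l: "l \<in> S" "matrix_power (A - mat l) k *v x = 0"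
    by (auto simp: gen_eigenspace_def)
  define p where "p = [:- l, 1:] ^ k"
  have p: "p \<noteq> 0" "\<forall>a. poly p a = 0 \<longrightarrow> a \<in> S" "poly_act A p x = 0"
    using l by (auto simp: p_def poly_act_linear_power poly_power)
  obtain q where q: "q \<noteq> 0" "\<forall>a. poly q a = 0 \<longrightarrow> a \<in> S" "poly_act A q y = 0"
    using step.IH by blast
  have "poly_act A (p * q) (c *s x + y) = 0"
    using p(3) q(3)
    by (simp add: poly_act_vec_add poly_act_vec_scale poly_act_mult poly_act_commute[of A p q x])
  then show ?case using p q by (intro exI[of _ "p * q"]) auto
qed

lemma spectral_subspace_disjoint:
  assumes "S \<inter> T = {}" "v \<in> spectral_subspace A S" "v \<in> spectral_subspace A T"
  shows "v = 0"
proof -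
  obtain q where q: "q \<noteq> 0" "\<forall>x. poly q x = 0 \<longrightarrow> x \<in> S" "poly_act A q v = 0"
    using spectral_subspace_annihilator[OF assms(2)] by blast
  obtain r where r: "r \<noteq> 0" "\<forall>x. poly r x = 0 \<longrightarrow> x \<in> T" "poly_act A r v = 0"
    using spectral_subspace_annihilator[OF assms(3)] by blast
  \<comment> \<open>A minimal annihilator divides \<open>q\<close> and \<open>r\<close>, which have no common root.\<close>
  obtain p where p: "p \<noteq> 0" "poly_act A p v = 0"
    and minimal: "\<And>h. h \<noteq> 0 \<Longrightarrow> poly_act A h v = 0 \<Longrightarrow> degree p \<le> degree h"
    using ex_has_least_nat[of "\<lambda>p. p \<noteq> 0 \<and> poly_act A p v = 0" q degree] q by blast
  have dvd: "p dvd h" if "poly_act A h v = 0" for h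
  proof (rule ccontr)
    assume "\<not> p dvd h"
    then have "h mod p \<noteq> 0" by (simp add: dvd_eq_mod_eq_0)
    moreover have "poly_act A (h mod p) v = 0"
    proof -
      have "poly_act A h v = poly_act A (h div p * p + h mod p) v" by simp
      also have "\<dots> = poly_act A (h mod p) v"
        using p(2) by (simp only: poly_act_add poly_act_mult) simp
      finally show ?thesis using that by simp
    qed
    ultimately have "degree p \<le> degree (h mod p)" by (rule minimal)
    then show False
      using degree_mod_less[OF p(1), of h] \<open>h mod p \<noteq> 0\<close> by linarith
  qed
  have "poly p x \<noteq> 0" for x
  proof
    assume "poly p x = 0"
    then have "poly q x = 0" "poly r x = 0"
      using dvd[OF q(3)] dvd[OF r(3)] by (auto elim!: dvdE)
    then show False using q(2) r(2) assms(1) by blast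
  qed
  then have "degree p = 0"
    using Fundamental_Theorem_Algebra.fundamental_theorem_of_algebra[of p] by (auto simp: constant_degree)
  then show ?thesis
    using p by (auto simp: poly_act_pCons elim!: degree_eq_zeroE)
qed

lemma spectral_subspace_invariant:
  assumes "v \<in> spectral_subspace A S"
  shows "A *v v \<in> spectral_subspace A S"
proof -
  have "A *v v \<in> gen_eigenspace A l" if "v \<in> gen_eigenspace A l" for v l
  proof -
    have "matrix_power (A - mat l) k *v (A *v v) = A *v (matrix_power (A - mat l) k *v v)" for k
    proof -
      have "A *v w = poly_act A [:0, 1:] w" for w by (simp add: poly_act_pCons)
      then show ?thesis
        by (simp only: poly_act_commute flip: poly_act_linear_power)
    qed
    then show ?thesis using that by (simp add: gen_eigenspace_def)
  qed
  then have "(*v) A ` (\<Union>l\<in>{l \<in> eigenvalues A. l \<in> S}. gen_eigenspace A l)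
      \<subseteq> (\<Union>l\<in>{l \<in> eigenvalues A. l \<in> S}. gen_eigenspace A l)"
    by blast
  then have "vec.span ((*v) A ` (\<Union>l\<in>{l \<in> eigenvalues A. l \<in> S}. gen_eigenspace A l))
      \<subseteq> spectral_subspace A S"
    unfolding spectral_subspace_def by (rule vec.span_mono)
  then show ?thesis using assms unfolding spectral_subspace_def vec.span_image by blast
qed

section \<open>The generalized eigenspaces span\<close>

lemma sum_lessThan_add_split:
  "(\<Sum>i<m + n. f i) = (\<Sum>i<m. f i) + (\<Sum>i<n. f (i + m :: nat))"
  by (induction n) (simp_all add: algebra_simps)

text \<open>
  If \<open>A\<close> acts on a family of vectors by a Jordan matrix, then every vector of the family is annihilated by
  \<open>(A - l) ^ m\<close> for some block of size \<open>m\<close> and eigenvalue \<open>l\<close>. The induction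
  splits off the first block, and the other blocks act on the shifted family.
\<close>
lemma jordan_basis_gen_eigenvector:
  fixes A :: "complex ^ 'n ^ 'n" and v :: "nat \<Rightarrow> complex ^ 'n"
  assumes "\<And>j. j < sum_list (map fst n_as) \<Longrightarrow>
      A *v v j = (\<Sum>i<sum_list (map fst n_as). jordan_matrix n_as $$ (i, j) *s v i)"
    and "j < sum_list (map fst n_as)"
  shows "\<exists>(m, l)\<in>set n_as. matrix_power (A - mat l) m *v v j = 0"
  using assms
proof (induction n_as arbitrary: v j)
  case (Cons b n_as)
  obtain m l where b: "b = (m, l)" by (cases b)
  define N where "N = sum_list (map fst n_as)"
  define J where "J = jordan_matrix n_as"
  have dims: "dim_row J = N" "dim_col J = N" by (simp_all add: J_def N_def)
  have index: "jordan_matrix (b # n_as) $$ (i, j) =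
      (if i < m then if j < m then jordan_block m l $$ (i, j) else 0
       else if j < m then 0 else J $$ (i - m, j - m))" if "i < m + N" "j < m + N" for i j
    using that unfolding b jordan_matrix_Cons
    by (auto simp: dims simp flip: J_def N_def)
  have Av: "A *v v j = (\<Sum>i<m. jordan_matrix (b # n_as) $$ (i, j) *s v i) +
      (\<Sum>i<N. jordan_matrix (b # n_as) $$ (i + m, j) *s v (i + m))" if "j < m + N" for j
    using Cons.prems(1)[of j] that
    by (simp add: b N_def[symmetric] sum_lessThan_add_split)
  show ?case
  proof (cases "j < m")
    case True
    \<comment> \<open>\<open>A - l\<close> moves the vectors of the first block down by one.\<close>
    have chain: "(A - mat l) *v v j = (if j = 0 then 0 else v (j - 1))" if "j < m" for j
    proof -
      have "A *v v j = (\<Sum>i<m. (if i = j then l else if Suc i = j then 1 else 0) *s v i)"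
        using Av[of j] that by (simp add: index)
      also have "\<dots> = (\<Sum>i<m. (if i = j then l *s v i else 0) +
          (if Suc i = j then v i else 0))"
        by (intro sum.cong) auto
      also have "\<dots> = l *s v j + (if j = 0 then 0 else v (j - 1))"
      proof (cases j)
        case (Suc j')
        then show ?thesis using that by (simp add: sum.distrib)
      qed (use that in \<open>simp add: sum.distrib\<close>)
      finally show ?thesis by (simp add: shifted_matrix_vec)
    qed
    have "matrix_power (A - mat l) (Suc j) *v v j = 0" if "j < m" for j
      using that
    proof (induction j)
      case 0
      then show ?case using chain[of 0] by (simp add: matrix_power_vec)
    next
      case (Suc j)
      have "matrix_power (A - mat l) (Suc (Suc j)) *v v (Suc j) =
          matrix_power (A - mat l) (Suc j) *v ((A - mat l) *v v (Suc j))"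
        by (simp add: matrix_power_vec funpow_swap1)
      then show ?case using chain[of "Suc j"] Suc by simp
    qed
    from matrix_power_vec_mono[OF this[OF True], of m]
    have "matrix_power (A - mat l) m *v v j = 0" using True by simp
    then show ?thesis by (auto simp: b)
  next
    case False
    define w where "w i = v (i + m)" for i
    have "A *v w i = (\<Sum>k<N. J $$ (k, i) *s w k)" if "i < N" for i
      using Av[of "i + m"] that by (simp add: index w_def)
    then have "\<exists>(k, a)\<in>set n_as. matrix_power (A - mat a) k *v w (j - m) = 0"
      using False Cons.prems(2) by (intro Cons.IH) (auto simp: b N_def J_def)
    then show ?thesis using False by (auto simp: w_def)
  qed
qed simp

lemma eigenvalue_of_gen_eigenvector:
  assumes "matrix_power (A - mat l) m *v v = 0" "v \<noteq> 0"
  shows "l \<in> eigenvalues A"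
  using assms
proof (induction m)
  case (Suc m)
  show ?case
  proof (cases "matrix_power (A - mat l) m *v v = 0")
    case False
    have "(A - mat l) *v (matrix_power (A - mat l) m *v v) = 0"
      using Suc.prems(1) by (simp add: matrix_power_vec)
    then show ?thesis
      using False by (auto simp: eigenvalues_def shifted_matrix_vec)
  qed (use Suc in auto)
qed (simp add: matrix_power_vec)

text \<open>
  The block sizes are bounded by the dimension, so the maximum is that of a finite set. This inequality
  suffices in what follows, and it does not need the uniqueness of the Jordan normal form.
\<close>
lemma jordan_block_size_le_largest:
  fixes A :: "complex ^ 'n ^ 'n"
  assumes "jordan_nf (indexed_mat A) n_as" "(m, l) \<in> set n_as"
  shows "m \<le> largest_jordan_block A l"
proof -
  have "k \<le> CARD('n)" if nf: "jordan_nf (indexed_mat A) ms" and "(k, l) \<in> set ms" for k ms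
  proof -
    obtain d P Q where "{indexed_mat A, jordan_matrix ms, P, Q} \<subseteq> carrier_mat d d"
      using nf similar_matD unfolding jordan_nf_def by blast
    then have "dim_row (indexed_mat A) = dim_row (jordan_matrix ms)" by auto
    then have "sum_list (map fst ms) = CARD('n)" by (simp add: indexed_mat_def)
    moreover have "k \<le> sum_list (map fst ms)"
      using that(2) by (intro member_le_sum_list) (force, simp)
    ultimately show ?thesis by simp
  qed
  then have "{m. \<exists>n_as. jordan_nf (indexed_mat A) n_as \<and> (m, l) \<in> set n_as} \<subseteq> {..CARD('n)}"
    by auto
  then have "finite {m. \<exists>n_as. jordan_nf (indexed_mat A) n_as \<and> (m, l) \<in> set n_as}"
    by (rule finite_subset) simp
  then show ?thesis
    unfolding largest_jordan_block_def by (rule Max_ge) (use assms in blast)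
qed

lemma spectral_subspace_UNIV:
  fixes A :: "complex ^ 'n ^ 'n"
  shows "spectral_subspace A UNIV = UNIV"
proof -
  define n where "n = CARD('n)"
  define e :: "nat \<Rightarrow> 'n" where "e = from_nat_into UNIV"
  define M where "M = indexed_mat A"
  have e: "bij_betw e {..<n} UNIV"
    unfolding e_def n_def by (rule bij_betw_from_nat_into_finite) simp
  have sum_e: "(\<Sum>k\<in>UNIV. g k) = (\<Sum>i<n. g (e i))" for g :: "'n \<Rightarrow> complex"
    using sum.reindex_bij_betw[OF e, of g] by simp
  have M: "M \<in> carrier_mat n n" "\<And>i j. i < n \<Longrightarrow> j < n \<Longrightarrow> M $$ (i, j) = A $ e i $ e j"
    by (auto simp: M_def indexed_mat_def n_def e_def)
  obtain n_as where nf: "jordan_nf M n_as"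
    using char_poly_factorized[OF M(1)] jordan_nf_exists[OF M(1)] by blast
  define J where "J = jordan_matrix n_as"
  obtain d P Q where "{M, J, P, Q} \<subseteq> carrier_mat d d"
    "P * Q = 1\<^sub>m d" "Q * P = 1\<^sub>m d" "M = P * J * Q"
    using nf similar_matD unfolding jordan_nf_def J_def by blast
  moreover from this have "d = n" using M(1) by auto
  ultimately have PQ: "P \<in> carrier_mat n n" "Q \<in> carrier_mat n n" "J \<in> carrier_mat n n"
    "P * Q = 1\<^sub>m n" "Q * P = 1\<^sub>m n" "M = P * J * Q"
    by auto
  have size: "sum_list (map fst n_as) = n" using PQ(3) by (auto simp: J_def)
  have "M * P = P * J * (Q * P)"
    unfolding PQ(6) using PQ(1-3) by (intro assoc_mult_mat[of _ n n _ n _ n]) auto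
  then have MP: "M * P = P * J"
    using PQ(1,3,5) by simp
  \<comment> \<open>The \<open>j\<close>-th column of \<open>P\<close>, indexed by the original index type.\<close>
  define v where "v j = (\<chi> k. P $$ (inv_into {..<n} e k, j))" for j
  have v: "v j $ e i = P $$ (i, j)" if "i < n" for i j
    using that e by (simp add: v_def bij_betw_inv_into_left)
  have eqI: "x = y" if "\<And>i. i < n \<Longrightarrow> x $ e i = y $ e i" for x y :: "complex ^ 'n"
  proof -
    have "x $ k = y $ k" for k
    proof -
      have "k \<in> e ` {..<n}" using bij_betw_imp_surj_on[OF e] by simp
      then show ?thesis using that by blast
    qed
    then show ?thesis by (simp add: vec_eq_iff)
  qed
  have "A *v v j = (\<Sum>i<n. J $$ (i, j) *s v i)" if "j < n" for j
  proof (rule eqI)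
    fix i assume "i < n"
    have "(A *v v j) $ e i = (\<Sum>k<n. M $$ (i, k) * P $$ (k, j))"
      using \<open>i < n\<close> by (simp add: matrix_vector_mult_def sum_e M(2) v)
    also have "\<dots> = (M * P) $$ (i, j)"
      using M(1) PQ(1) \<open>i < n\<close> \<open>j < n\<close> by (simp add: scalar_prod_def lessThan_atLeast0)
    also have "\<dots> = (\<Sum>k<n. P $$ (i, k) * J $$ (k, j))"
      unfolding MP using PQ(1,3) \<open>i < n\<close> \<open>j < n\<close> by (simp add: scalar_prod_def lessThan_atLeast0)
    also have "\<dots> = (\<Sum>k<n. J $$ (k, j) *s v k) $ e i"
      using \<open>i < n\<close> by (simp add: v mult.commute)
    finally show "(A *v v j) $ e i = (\<Sum>k<n. J $$ (k, j) *s v k) $ e i" .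
  qed
  then have gen: "\<exists>(m, l)\<in>set n_as. matrix_power (A - mat l) m *v v j = 0" if "j < n" for j
    using that by (intro jordan_basis_gen_eigenvector) (simp_all add: size J_def)
  have v_in: "v j \<in> spectral_subspace A UNIV" if "j < n" for j
  proof (cases "v j = 0")
    case True
    then show ?thesis by (simp add: spectral_subspace_def vec.span_zero)
  next
    case False
    obtain m l where ml: "(m, l) \<in> set n_as" "matrix_power (A - mat l) m *v v j = 0"
      using gen[OF \<open>j < n\<close>] by auto
    then have "v j \<in> gen_eigenspace A l" "l \<in> eigenvalues A"
      using nf False unfolding M_def gen_eigenspace_def
      by (auto intro: matrix_power_vec_mono jordan_block_size_le_largest eigenvalue_of_gen_eigenvector)
    then show ?thesis unfolding spectral_subspace_def by (intro vec.span_base) auto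
  qed
  have "x \<in> spectral_subspace A UNIV" for x :: "complex ^ 'n"
  proof -
    define c where "c j = (\<Sum>k<n. Q $$ (j, k) * x $ e k)" for j
    have "x = (\<Sum>j<n. c j *s v j)"
    proof (rule eqI)
      fix i assume "i < n"
      have "(\<Sum>j<n. c j *s v j) $ e i = (\<Sum>j<n. \<Sum>k<n. P $$ (i, j) * Q $$ (j, k) * x $ e k)"
        using \<open>i < n\<close> by (simp add: v c_def sum_distrib_left mult_ac)
      also have "\<dots> = (\<Sum>k<n. (\<Sum>j<n. P $$ (i, j) * Q $$ (j, k)) * x $ e k)"
        by (subst sum.swap) (simp add: sum_distrib_right)
      also have "\<dots> = (\<Sum>k<n. (P * Q) $$ (i, k) * x $ e k)"
        using PQ(1,2) \<open>i < n\<close>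
        by (intro sum.cong) (auto simp: scalar_prod_def lessThan_atLeast0)
      also have "\<dots> = (\<Sum>k<n. if k = i then x $ e k else 0)"
        unfolding PQ(4) using \<open>i < n\<close> by (intro sum.cong) auto
      also have "\<dots> = x $ e i" using \<open>i < n\<close> by simp
      finally show "x $ e i = (\<Sum>j<n. c j *s v j) $ e i" by simp
    qed
    then show ?thesis
      using v_in subspace_spectral_subspace[of A UNIV]
      by (auto intro!: vec.subspace_sum vec.subspace_scale)
  qed
  then show ?thesis by blast
qed

lemma stable_subspace_eq: "stable_subspace A = spectral_subspace A {l. Re l < 0}"
  by (simp add: stable_subspace_def spectral_subspace_def)

lemma spectral_subspace_Un:
  "spectral_subspace A (S \<union> T) = {x + y |x y. x \<in> spectral_subspace A S \<and> y \<in> spectral_subspace A T}"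
proof -
  have "(\<Union>l\<in>{l \<in> eigenvalues A. l \<in> S \<union> T}. gen_eigenspace A l) =
      (\<Union>l\<in>{l \<in> eigenvalues A. l \<in> S}. gen_eigenspace A l) \<union>
      (\<Union>l\<in>{l \<in> eigenvalues A. l \<in> T}. gen_eigenspace A l)"
    by blast
  then show ?thesis unfolding spectral_subspace_def by (simp only: vec.span_Un)
qed

lemma center_unstable_subspace_eq: "center_unstable_subspace A = spectral_subspace A {l. Re l \<ge> 0}"
proof -
  have "unstable_subspace A = spectral_subspace A {l. Re l > 0}"
    "center_subspace A = spectral_subspace A {l. Re l = 0}"
    by (simp_all add: unstable_subspace_def center_subspace_def spectral_subspace_def)
  moreover have "{l. Re l \<ge> 0} = {l. Re l > 0} \<union> {l. Re l = 0}" by auto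
  ultimately show ?thesis
    by (simp only: center_unstable_subspace_def spectral_subspace_Un)
qed

section \<open>The projections of the stable splitting\<close>

lemma proj_along_eq:
  assumes "vec.subspace S" "vec.subspace T" "S \<inter> T = {0}" "x \<in> S" "y \<in> T"
  shows "proj_along S T (x + y) = x"
  unfolding proj_along_def
proof (rule the_equality)
  show "x \<in> S \<and> x + y - x \<in> T" using assms by simp
next
  fix x' assume x': "x' \<in> S \<and> x + y - x' \<in> T"
  have "x - x' \<in> S" using assms x' by (simp add: vec.subspace_diff)
  moreover have "x + y - x' - y \<in> T"
    by (rule vec.subspace_diff[OF assms(2) conjunct2[OF x'] assms(5)])
  then have "x - x' \<in> T" by (simp add: algebra_simps)
  ultimately have "x - x' \<in> S \<inter> T" by blast
  then show "x' = x" using assms(3) by simp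
qed

lemma stable_center_unstable_decomposition:
  "stable_proj A z + center_unstable_proj A z = z"
  "center_unstable_proj A z \<in> center_unstable_subspace A"
proof -
  define S T where "S = stable_subspace A" and "T = center_unstable_subspace A"
  have sub: "vec.subspace S" "vec.subspace T"
    by (simp_all add: S_def T_def stable_subspace_eq center_unstable_subspace_eq
        subspace_spectral_subspace)
  have "v = 0" if "v \<in> S" "v \<in> T" for v
  proof -
    have "{l. Re l < 0} \<inter> {l. Re l \<ge> 0} = {}" by auto
    from spectral_subspace_disjoint[OF this] show ?thesis
      using that by (simp add: S_def T_def stable_subspace_eq center_unstable_subspace_eq)
  qed
  then have int: "S \<inter> T = {0}" using sub by (auto simp: vec.subspace_0)
  have "{l. Re l < 0} \<union> {l. Re l \<ge> 0} = UNIV" by auto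
  then have "z \<in> {x + y |x y. x \<in> S \<and> y \<in> T}"
    using spectral_subspace_Un[of A "{l. Re l < 0}" "{l. Re l \<ge> 0}"] spectral_subspace_UNIV[of A]
    by (simp add: S_def T_def stable_subspace_eq center_unstable_subspace_eq)
  then obtain x y where xy: "x \<in> S" "y \<in> T" "z = x + y" by blast
  have "stable_proj A z = x"
    using proj_along_eq[OF sub int xy(1,2)] by (simp add: stable_proj_def S_def T_def xy(3))
  moreover have "center_unstable_proj A z = y"
    using proj_along_eq[OF sub(2,1) _ xy(2,1)] int
    by (simp add: center_unstable_proj_def S_def T_def xy(3) add.commute Int_commute)
  ultimately show "stable_proj A z + center_unstable_proj A z = z"
    "center_unstable_proj A z \<in> center_unstable_subspace A"
    using xy by (auto simp: T_def)
qed

section \<open>The flow in complex time\<close>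

text \<open>
  The matrix \<open>exp (t A)\<close> for complex \<open>t\<close>, defined entry by entry so that its holomorphy in \<open>t\<close> is that
  of a power series.
\<close>
definition complex_flow :: "complex ^ 'n ^ 'n \<Rightarrow> complex \<Rightarrow> complex ^ 'n ^ 'n" where
  "complex_flow A t = (\<chi> i j. \<Sum>k. (matrix_power A k $ i $ j / fact k) * t ^ k)"

lemma matrix_power_Suc_entry:
  "matrix_power A (Suc k) $ i $ j = (\<Sum>l\<in>UNIV. A $ i $ l * matrix_power A k $ l $ j)"
  by (simp add: matrix_power_def matrix_matrix_mult_def)

lemma matrix_power_entry_bound:
  fixes A :: "complex ^ 'n ^ 'n"
  obtains C where "\<And>k i j. norm (matrix_power A k $ i $ j) \<le> C ^ k"
proof
  define C where "C = 1 + (\<Sum>i\<in>UNIV. \<Sum>j\<in>UNIV. norm (A $ i $ j))"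
  have C: "0 \<le> C" "\<And>i. (\<Sum>l\<in>UNIV. norm (A $ i $ l)) \<le> C"
  proof -
    show "0 \<le> C" by (auto simp: C_def intro!: add_nonneg_nonneg sum_nonneg)
    fix i
    have "(\<Sum>l\<in>UNIV. norm (A $ i $ l)) \<le> (\<Sum>i\<in>UNIV. \<Sum>l\<in>UNIV. norm (A $ i $ l))"
      by (rule member_le_sum) (auto intro: sum_nonneg)
    then show "(\<Sum>l\<in>UNIV. norm (A $ i $ l)) \<le> C" by (simp add: C_def)
  qed
  show "norm (matrix_power A k $ i $ j) \<le> C ^ k" for k i j
  proof (induction k arbitrary: i)
    case 0
    show ?case by (simp add: matrix_power_def mat_def)
  next
    case (Suc k)
    have "norm (matrix_power A (Suc k) $ i $ j)
        \<le> (\<Sum>l\<in>UNIV. norm (A $ i $ l) * norm (matrix_power A k $ l $ j))"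
      unfolding matrix_power_Suc_entry norm_mult[symmetric] by (rule norm_sum)
    also have "\<dots> \<le> (\<Sum>l\<in>UNIV. norm (A $ i $ l) * C ^ k)"
      by (intro sum_mono mult_left_mono Suc.IH norm_ge_zero)
    also have "\<dots> = (\<Sum>l\<in>UNIV. norm (A $ i $ l)) * C ^ k"
      by (simp add: sum_distrib_right)
    also have "\<dots> \<le> C * C ^ k"
      using C by (intro mult_right_mono) auto
    finally show ?case by simp
  qed
qed

lemma complex_flow_entry_sums:
  "(\<lambda>k. (matrix_power A k $ i $ j / fact k) * t ^ k) sums (complex_flow A t $ i $ j)"
proof -
  obtain C where C: "\<And>k i j. norm (matrix_power A k $ i $ j) \<le> C ^ k"
    using matrix_power_entry_bound by blast
  have "summable (\<lambda>k. (C * norm t) ^ k / fact k)"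
    using summable_exp[of "C * norm t"] by (simp add: field_simps)
  moreover have "norm (matrix_power A k $ i $ j / fact k * t ^ k) \<le> (C * norm t) ^ k / fact k" for k
    using mult_right_mono[OF C[of k i j], of "norm t ^ k / fact k"]
    by (simp add: norm_mult norm_divide norm_power power_mult_distrib)
  ultimately have "summable (\<lambda>k. (matrix_power A k $ i $ j / fact k) * t ^ k)"
    by (meson summable_comparison_test')
  then show ?thesis by (simp add: complex_flow_def summable_sums)
qed

lemma complex_flow_holomorphic: "(\<lambda>t. complex_flow A t $ i $ j) holomorphic_on UNIV"
proof -
  have "(\<lambda>t. complex_flow A t $ i $ j) holomorphic_on ball 0 r" for r
    using complex_flow_entry_sums
    by (intro power_series_holomorphic[where a = "\<lambda>k. matrix_power A k $ i $ j / fact k"]) auto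
  then have "(\<lambda>t. complex_flow A t $ i $ j) field_differentiable at t" for t
    using holomorphic_on_imp_differentiable_at[of _ "ball 0 (norm t + 1)" t] by simp
  then show ?thesis
    by (auto simp: holomorphic_on_def intro: field_differentiable_at_within)
qed

lemma complex_flow_0: "complex_flow A 0 = mat 1"
  using sums_unique2[OF complex_flow_entry_sums[of A _ _ 0] powser_sums_zero]
  by (simp add: vec_eq_iff matrix_power_def)

lemma matrix_power_scaleR: "matrix_power (t *\<^sub>R A) k = t ^ k *\<^sub>R matrix_power A k"
proof (induction k)
  case (Suc k)
  have "matrix_power (t *\<^sub>R A) (Suc k) $ i $ j = (t ^ Suc k *\<^sub>R matrix_power A (Suc k)) $ i $ j" for i j
    by (simp only: matrix_power_Suc_entry Suc vector_scaleR_component)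
      (simp add: scaleR_conv_of_real[where 'a = complex] sum_distrib_left mult_ac matrix_power_Suc_entry)
  then show ?case by (simp add: vec_eq_iff)
qed (simp add: matrix_power_def)

lemma matrix_exp_scaleR_eq_complex_flow: "matrix_exp (t *\<^sub>R A) = complex_flow A (of_real t)"
proof -
  have "(\<lambda>k. (1 / fact k) *\<^sub>R matrix_power (t *\<^sub>R A) k) sums complex_flow A (of_real t)"
    unfolding sums_def
  proof (intro vec_tendstoI)
    fix i j
    show "(\<lambda>n. (\<Sum>k<n. (1 / fact k) *\<^sub>R matrix_power (t *\<^sub>R A) k) $ i $ j)
        \<longlonglongrightarrow> complex_flow A (of_real t) $ i $ j"
      using complex_flow_entry_sums[of A i j "of_real t"]
      by (simp add: sums_def matrix_power_scaleR scaleR_conv_of_real[where 'a = complex] mult_ac)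
  qed
  then show ?thesis unfolding matrix_exp_def by (simp add: sums_iff)
qed

lemma complex_flow_vec_sums:
  "(\<lambda>k. (t ^ k / fact k) *s (matrix_power A k *v v)) sums (complex_flow A t *v v)"
  unfolding sums_def
proof (rule vec_tendstoI)
  fix i
  have "(\<lambda>k. \<Sum>j\<in>UNIV. (matrix_power A k $ i $ j / fact k) * t ^ k * v $ j)
      sums (\<Sum>j\<in>UNIV. complex_flow A t $ i $ j * v $ j)"
    by (intro sums_sum sums_mult2 complex_flow_entry_sums)
  then show "(\<lambda>n. (\<Sum>k<n. (t ^ k / fact k) *s (matrix_power A k *v v)) $ i)
      \<longlonglongrightarrow> (complex_flow A t *v v) $ i"
    by (simp add: sums_def matrix_vector_mult_def sum_distrib_left mult_ac)
qed

lemma complex_flow_invariant_subspace: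
  fixes A :: "complex ^ 'n ^ 'n"
  assumes "vec.subspace E" "\<And>v. v \<in> E \<Longrightarrow> A *v v \<in> E" "v \<in> E"
  shows "complex_flow A t *v v \<in> E"
proof -
  have "c *\<^sub>R x = of_real c *s x" for c and x :: "complex ^ 'n"
    by (simp add: vec_eq_iff scaleR_conv_of_real[where 'a = complex])
  then have "closed E"
    using assms(1)
    by (intro closed_subspace real_vector.subspaceI) (simp_all add: vec.subspace_def)
  have "matrix_power A k *v v \<in> E" for k
    by (induction k) (simp_all add: matrix_power_vec assms)
  then have "(\<Sum>k<n. (t ^ k / fact k) *s (matrix_power A k *v v)) \<in> E" for n
    using assms(1) by (intro vec.subspace_sum vec.subspace_scale) auto
  then show ?thesis
    by (rule closed_sequentially[OF \<open>closed E\<close> _ complex_flow_vec_sums[unfolded sums_def]])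
qed

section \<open>Runge domains\<close>

theorem theorem1p1:
  fixes A :: "complex ^ 'n ^ 'n" and \<Omega> :: "(complex ^ 'n) set"
  assumes "invertible A"
    and "is_domain \<Omega>"
    and "positive_time_flow_invariant A \<Omega>"
    and "center_unstable_subspace A \<subseteq> \<Omega>"
    and "\<And>K :: (complex ^ 'n) set. compact K \<Longrightarrow>
           \<exists>T>0. \<forall>t\<ge>T.
             set_dist ((\<lambda>z. matrix_exp (t *\<^sub>R A) *v center_unstable_proj A z) ` K) (frontier \<Omega>)
               > (SUP z\<in>K. ereal (norm (matrix_exp (t *\<^sub>R A) *v stable_proj A z)))"
  shows "runge_domain \<Omega>"
proof -
  have "open \<Omega>" using assms(2) by (simp add: is_domain_def)
  have swallow: "\<exists>T. \<forall>t\<ge>T. \<forall>z\<in>cball 0 r. complex_flow A (of_real t) *v z \<in> \<Omega>" for r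
  proof -
    obtain T where T: "\<And>t. t \<ge> T \<Longrightarrow>
        set_dist ((\<lambda>z. complex_flow A (of_real t) *v center_unstable_proj A z) ` cball 0 r) (frontier \<Omega>)
          > (SUP z\<in>cball 0 r. ereal (norm (complex_flow A (of_real t) *v stable_proj A z)))"
      using assms(5)[OF compact_cball, of 0 r] by (auto simp: matrix_exp_scaleR_eq_complex_flow)
    have "complex_flow A (of_real t) *v z \<in> \<Omega>" if "t \<ge> T" "z \<in> cball 0 r" for t z
    proof (rule ccontr)
      define x where "x = complex_flow A (of_real t) *v center_unstable_proj A z"
      define y where "y = complex_flow A (of_real t) *v stable_proj A z"
      have "complex_flow A (of_real t) *v z = y + x"
        unfolding x_def y_def
        by (simp only: stable_center_unstable_decomposition(1) flip: vec.add)
      moreover assume "complex_flow A (of_real t) *v z \<notin> \<Omega>"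
      ultimately have "x + y \<notin> \<Omega>" by (simp add: add.commute)
      moreover have "x \<in> \<Omega>"
      proof -
        have "x \<in> center_unstable_subspace A"
          using stable_center_unstable_decomposition(2)[of A z]
          unfolding x_def center_unstable_subspace_eq
          by (intro complex_flow_invariant_subspace subspace_spectral_subspace
              spectral_subspace_invariant)
        then show ?thesis using assms(4) by blast
      qed
      \<comment> \<open>The segment starts in \<open>\<Omega>\<close> and ends outside, so it meets the boundary within \<open>norm y\<close> of \<open>x\<close>.\<close>
      ultimately have "closed_segment x (x + y) \<inter> frontier \<Omega> \<noteq> {}"
        by (intro connected_Int_frontier) auto
      then obtain p where p: "p \<in> closed_segment x (x + y)" "p \<in> frontier \<Omega>" by blast
      have "set_dist ((\<lambda>z. complex_flow A (of_real t) *v center_unstable_proj A z) ` cball 0 r)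
          (frontier \<Omega>) \<le> ereal (norm (x - p))"
      proof -
        have "x \<in> (\<lambda>z. complex_flow A (of_real t) *v center_unstable_proj A z) ` cball 0 r"
          unfolding x_def using that(2) by (rule imageI)
        then show ?thesis
          unfolding set_dist_def using p(2) by (intro Inf_lower) blast
      qed
      also have "norm (x - p) \<le> norm y"
        using segment_bound(1)[OF p(1)] by (simp add: norm_minus_commute)
      also have "ereal (norm y) \<le>
          (SUP z\<in>cball 0 r. ereal (norm (complex_flow A (of_real t) *v stable_proj A z)))"
        unfolding y_def using that(2) by (rule SUP_upper)
      finally show False using T[OF that(1)] by simp
    qed
    then show ?thesis by blast
  qed
  have "poly_approximable K f" if "holomorphic_several f \<Omega>" "compact K" "K \<subseteq> \<Omega>" for f K
  proof (rule poly_approximable_of_entire_matrix_flow[OF \<open>open \<Omega>\<close> that(1,2)])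
    show "complex_flow A (of_real t) *v z \<in> \<Omega>" if "0 \<le> t" "z \<in> K" for t z
      using assms(3) that \<open>K \<subseteq> \<Omega>\<close>
      by (auto simp: positive_time_flow_invariant_def matrix_exp_scaleR_eq_complex_flow)
  qed (intro complex_flow_holomorphic complex_flow_0 swallow)+
  then show ?thesis
    using assms(2) by (auto simp: runge_domain_def poly_approximable_def)
qed

end
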